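(* Let $\mathrm{k}$ be an algebraically closed field of characteristic $p$ and let $n\geq 1$ be an integer that is a multiple of $p$. Then every near-pencil arrangement of $n+1$ lines in $\mathbb{P}^2_{\mathrm{k}}$ is homaloidal.
   Context: A near-pencil arrangement of $n+1$ lines in $\mathbb{P}^2_{\mathrm{k}}$ is the union of $n$ distinct lines through a given point $z_0$ together with one further line not passing through $z_0$. For a homogeneous polynomial $f\in \mathrm{k}[x_0,x_1,x_2]$, the polar map $\Phi_f:\mathbb{P}^2_{\mathrm{k}}\dashrightarrow\mathbb{P}^2_{\mathrm{k}}$ is the rational map defined by the partial derivatives $\left(\frac{\partial f}{\partial x_0}:\frac{\partial f}{\partial x_1}:\frac{\partial f}{\partial x_2}\right)$. The polynomial $f$ is called homaloidal if the linear system $\langle \frac{\partial f}{\partial x_0},\frac{\partial f}{\partial x_1},\frac{\partial f}{\partial x_2}\rangle$ has no fixed component (i.e. the three partial derivatives have no common factor of positive degree) and $\Phi_f$ is birational. A reduced projective plane curve $F=\mathbb{V}(f)\subset\mathbb{P}^2_{\mathrm{k}}$, with $f$ its reduced equation, is called homaloidal if $f$ is homaloidal. *)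

theory Defs
  imports
    "HOL-Analysis.Cartesian_Space"
    "HOL-Library.Poly_Mapping"
    "HOL-Library.Numeral_Type"
    "HOL-Computational_Algebra.Polynomial"
    "HOL-Computational_Algebra.Squarefree"
begin

section \<open>Polynomials in three variables\<close>

text \<open>
  The index type \<^typ>\<open>3\<close> has the three elements 0, 1, 2. Finitely supported functions from
  exponent vectors to a field form the ring k[x_0, x_1, x_2]; its ring operations (convolution
  product) are the ones of \<^theory>\<open>HOL-Library.Poly_Mapping\<close>.
\<close>

type_synonym mono3 = "3 \<Rightarrow>\<^sub>0 nat"
type_synonym 'a poly3 = "mono3 \<Rightarrow>\<^sub>0 'a"

definition mono_degree :: "mono3 \<Rightarrow> nat" where
  "mono_degree m = (\<Sum>i\<in>UNIV. Poly_Mapping.lookup m i)"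

definition total_degree :: "'a::zero poly3 \<Rightarrow> nat" where
  "total_degree f = Max (insert 0 (mono_degree ` Poly_Mapping.keys f))"

text \<open>The zero polynomial is homogeneous of every degree.\<close>

definition homogeneous :: "nat \<Rightarrow> 'a::zero poly3 \<Rightarrow> bool" where
  "homogeneous d f \<longleftrightarrow> (\<forall>m\<in>Poly_Mapping.keys f. mono_degree m = d)"

definition coord :: "3 \<Rightarrow> 'a::comm_ring_1 poly3" where
  "coord i = Poly_Mapping.single (Poly_Mapping.single i 1) 1"

definition eval3 :: "'a::comm_ring_1 poly3 \<Rightarrow> 'a ^ 3 \<Rightarrow> 'a" where
  "eval3 f v = (\<Sum>m\<in>Poly_Mapping.keys f.
     Poly_Mapping.lookup f m * (\<Prod>i\<in>UNIV. (v $ i) ^ Poly_Mapping.lookup m i))"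

definition subst3 :: "'a::comm_ring_1 poly3 \<Rightarrow> (3 \<Rightarrow> 'a poly3) \<Rightarrow> 'a poly3" where
  "subst3 f G = (\<Sum>m\<in>Poly_Mapping.keys f.
     Poly_Mapping.single 0 (Poly_Mapping.lookup f m) * (\<Prod>i\<in>UNIV. G i ^ Poly_Mapping.lookup m i))"

text \<open>
  The subtraction of exponent vectors below is truncated; where it matters, the exponent of the
  \<open>i\<close>-th variable is 0, so the coefficient vanishes.
\<close>

definition partial3 :: "3 \<Rightarrow> 'a::comm_ring_1 poly3 \<Rightarrow> 'a poly3" where
  "partial3 i f = (\<Sum>m\<in>Poly_Mapping.keys f.
     Poly_Mapping.single (m - Poly_Mapping.single i 1)
       (of_nat (Poly_Mapping.lookup m i) * Poly_Mapping.lookup f m))"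

section \<open>The projective plane\<close>

text \<open>A point of the projective plane is a one-dimensional subspace of \<open>k\<^sup>3\<close>.\<close>

definition proj_plane :: "('a::field ^ 3) set set" where
  "proj_plane = {z. vec.subspace z \<and> vec.dim z = 1}"

definition zero_locus :: "'a::field poly3 \<Rightarrow> ('a ^ 3) set set" where
  "zero_locus f = {z \<in> proj_plane. \<forall>v\<in>z. eval3 f v = 0}"

definition proj_line :: "('a::field ^ 3) set set \<Rightarrow> bool" where
  "proj_line L \<longleftrightarrow> (\<exists>l. l \<noteq> 0 \<and> homogeneous 1 l \<and> L = zero_locus l)"

text \<open>The parameter \<open>n\<close> counts the concurrent lines only: the arrangement has \<open>n + 1\<close> lines.\<close>

definition near_pencil :: "nat \<Rightarrow> ('a::field ^ 3) set set \<Rightarrow> bool" where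
  "near_pencil n F \<longleftrightarrow> (\<exists>z0\<in>proj_plane. \<exists>\<L> M.
     finite \<L> \<and> card \<L> = n \<and> (\<forall>L\<in>\<L>. proj_line L \<and> z0 \<in> L) \<and>
     proj_line M \<and> z0 \<notin> M \<and> F = \<Union>\<L> \<union> M)"

section \<open>Rational maps of the projective plane\<close>

text \<open>
  A rational map of the plane to itself is represented by three forms of the same degree, not all
  zero. Common factors are allowed, and two representatives give the same map iff all their
  \<open>2 \<times> 2\<close> minors vanish.
\<close>

definition rational_map :: "(3 \<Rightarrow> 'a::field poly3) \<Rightarrow> bool" where
  "rational_map \<Phi> \<longleftrightarrow> (\<exists>d. \<forall>i. homogeneous d (\<Phi> i)) \<and> (\<exists>i. \<Phi> i \<noteq> 0)"

definition same_map :: "(3 \<Rightarrow> 'a::field poly3) \<Rightarrow> (3 \<Rightarrow> 'a poly3) \<Rightarrow> bool" where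
  "same_map \<Phi> \<Psi> \<longleftrightarrow> (\<forall>i j. \<Phi> i * \<Psi> j = \<Phi> j * \<Psi> i)"

definition comp_map :: "(3 \<Rightarrow> 'a::field poly3) \<Rightarrow> (3 \<Rightarrow> 'a poly3) \<Rightarrow> (3 \<Rightarrow> 'a poly3)" where
  "comp_map \<Psi> \<Phi> = (\<lambda>i. subst3 (\<Psi> i) \<Phi>)"

text \<open>
  Birational means having a rational inverse. The requirement that the composites are again
  rational maps says that they are defined, i.e. that substituting does not make all three
  components vanish.
\<close>

definition birational :: "(3 \<Rightarrow> 'a::field poly3) \<Rightarrow> bool" where
  "birational \<Phi> \<longleftrightarrow> rational_map \<Phi> \<and> (\<exists>\<Psi>. rational_map \<Psi> \<and>
     rational_map (comp_map \<Psi> \<Phi>) \<and> same_map (comp_map \<Psi> \<Phi>) coord \<and>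
     rational_map (comp_map \<Phi> \<Psi>) \<and> same_map (comp_map \<Phi> \<Psi>) coord)"

definition polar_map :: "'a::field poly3 \<Rightarrow> (3 \<Rightarrow> 'a poly3)" where
  "polar_map f = (\<lambda>i. partial3 i f)"

definition homaloidal :: "'a::field poly3 \<Rightarrow> bool" where
  "homaloidal f \<longleftrightarrow> (\<exists>d. homogeneous d f) \<and>
     (\<forall>h. (\<forall>i. h dvd polar_map f i) \<longrightarrow> total_degree h = 0) \<and>
     birational (polar_map f)"

text \<open>
  Over an algebraically closed field, reduced curves correspond to their sets of points, and the
  reduced equation of a curve is unique up to a nonzero scalar, which does not affect being
  homaloidal.
\<close>

definition reduced_equation :: "'a::field poly3 \<Rightarrow> ('a ^ 3) set set \<Rightarrow> bool" where
  "reduced_equation f F \<longleftrightarrow> (\<exists>d. homogeneous d f) \<and> squarefree f \<and> F = zero_locus f"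

definition homaloidal_curve :: "('a::alg_closed_field ^ 3) set set \<Rightarrow> bool" where
  "homaloidal_curve F \<longleftrightarrow> (\<exists>f. reduced_equation f F \<and> homaloidal f)"

end

theory Submission
  imports Defs
begin

text \<open>
  Let \<open>f = G m\<close>, where \<open>G\<close> is the product of the \<open>n\<close> linear forms through the point \<open>v\<close> and
  \<open>m(x) = b \<bullet> x\<close> is the remaining form, normalised by \<open>m(v) = 1\<close>. Since \<open>n = 0\<close> in the field,
  Euler's relation says that \<open>\<nabla>G\<close> is orthogonal to \<open>x\<close>; it is also orthogonal to \<open>v\<close>. Hence
  \<open>b \<times> \<nabla>G\<close> is parallel to \<open>x - m(x) v\<close>, and so the vector \<open>y = b \<times> w\<close>, where
  \<open>w = m \<nabla>G + G b\<close> is the polar map, determines \<open>x\<close> modulo \<open>v\<close>. As \<open>w \<bullet> v = G\<close>, the map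
  \<open>w \<mapsto> (w \<bullet> v) (b \<times> \<nabla>G(y)) + G(y) v\<close> is a rational inverse. Instead of the polynomial
  proportionality factor in \<open>b \<times> \<nabla>G \<parallel> x - m(x) v\<close>, the computation carries
  one component of each side, which avoids dividing in the polynomial ring.
  A common factor of the partial derivatives divides \<open>w \<bullet> v = G\<close>; linear forms being prime, it
  is constant, since no linear factor of \<open>G\<close> divides all components of \<open>\<nabla>G\<close>.
\<close>

section \<open>Vectors of length three\<close>

text \<open>Vectors are functions over any commutative ring, so that the same identities serve
  scalar vectors and vectors of polynomials.\<close>

definition dot :: "(3 \<Rightarrow> 'a::comm_ring_1) \<Rightarrow> (3 \<Rightarrow> 'a) \<Rightarrow> 'a" where
  "dot u v = (\<Sum>i\<in>UNIV. u i * v i)"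

text \<open>Index arithmetic in type \<open>3\<close> is modulo 3, which makes one cyclic formula
  cover all components.\<close>

definition cross :: "(3 \<Rightarrow> 'a::comm_ring_1) \<Rightarrow> (3 \<Rightarrow> 'a) \<Rightarrow> 3 \<Rightarrow> 'a" where
  "cross u v = (\<lambda>i. u (i + 1) * v (i + 2) - u (i + 2) * v (i + 1))"

lemma dot_3: "dot u v = u 1 * v 1 + u 2 * v 2 + u 3 * v 3"
  by (simp add: dot_def sum_3)

lemma cross_3:
  "cross u v 1 = u 2 * v 3 - u 3 * v 2"
  "cross u v 2 = u 3 * v 1 - u 1 * v 3"
  "cross u v 3 = u 1 * v 2 - u 2 * v 1"
proof -
  have "(1 :: 3) + 1 = 2" "(1 :: 3) + 2 = 3" "(2 :: 3) + 1 = 3"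
    "(2 :: 3) + 2 = 1" "(3 :: 3) + 1 = 1" "(3 :: 3) + 2 = 2"
    by simp_all
  then show "cross u v 1 = u 2 * v 3 - u 3 * v 2" "cross u v 2 = u 3 * v 1 - u 1 * v 3"
    "cross u v 3 = u 1 * v 2 - u 2 * v 1"
    by (simp_all only: cross_def)
qed

lemma dot_commute: "dot u v = dot v u"
  by (simp add: dot_def mult.commute)

lemma dot_sum: "dot u (\<lambda>j. \<Sum>k\<in>A. g k j) = (\<Sum>k\<in>A. dot u (g k))"
  unfolding dot_def sum_distrib_left by (rule sum.swap)

lemma dot_add: "dot u (\<lambda>j. g j + h j) = dot u g + dot u h"
  by (simp add: dot_3 algebra_simps)

lemma dot_scale: "dot u (\<lambda>j. c * g j) = c * dot u g"
  by (simp add: dot_3 algebra_simps)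

lemma dot_scale': "dot u (\<lambda>j. g j * c) = dot u g * c"
  by (simp add: dot_3 algebra_simps)

lemma dot_diff: "dot u (\<lambda>j. g j - h j) = dot u g - dot u h"
  by (simp add: dot_3 algebra_simps)

lemmas dot_linear = dot_add dot_diff dot_scale dot_scale'

lemma dot_cross_self: "dot u (cross u v) = 0"
  by (simp add: dot_3 cross_3 algebra_simps)

lemma dot_cross_rotate: "dot u (cross v w) = dot (cross u v) w"
  by (simp add: dot_3 cross_3 algebra_simps)

lemma all_3I: "P 1 \<Longrightarrow> P 2 \<Longrightarrow> P 3 \<Longrightarrow> P (i :: 3)"
  using exhaust_3[of i] by auto

lemma cross_cross_right: "cross u (cross v w) i = v i * dot u w - w i * dot u v"
  by (rule all_3I[of _ i]) (simp_all add: dot_3 cross_3 algebra_simps)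

lemma cross_cross_left: "cross (cross u v) w i = v i * dot u w - u i * dot v w"
  by (rule all_3I[of _ i]) (simp_all add: dot_3 cross_3 algebra_simps)

text \<open>For \<open>g = dG y\<close> both terms on the right vanish, so that
  \<open>cross b g\<close> and \<open>cross b (cross y v)\<close> are parallel.\<close>

lemma cross_cross_cross:
  "cross (cross b g) (cross b (cross y v)) i = b i * (dot b y * dot g v - dot b v * dot g y)"
  by (rule all_3I[of _ i]) (simp_all add: dot_3 cross_3 algebra_simps)

lemma cross_commute: "cross u v i = - cross v u i"
  by (simp add: cross_def mult.commute)

lemma cross_eq_0_iff: "(\<forall>i. cross u v i = 0) \<longleftrightarrow> (\<forall>i j. u i * v j = u j * v i)"
  by (simp add: forall_3 cross_3) (auto simp: mult.commute)

lemma cross_scale: "cross u (\<lambda>j. c * g j) i = c * cross u g i"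
  by (simp add: cross_def algebra_simps)

section \<open>The polar map of a pencil with a further line\<close>

text \<open>An integral domain is allowed in place of a field because the results are applied in the
  polynomial ring, with constant vectors \<open>a k\<close>, \<open>b\<close>,
  \<open>v\<close>.\<close>

locale pencil_with_line =
  fixes I :: "'i set" and a :: "'i \<Rightarrow> 3 \<Rightarrow> 'r::idom" and b v :: "3 \<Rightarrow> 'r"
  assumes finite_I: "finite I" and I_nonempty: "I \<noteq> {}"
    and of_nat_card: "of_nat (card I) = (0 :: 'r)"
    and dot_a_v: "k \<in> I \<Longrightarrow> dot (a k) v = 0"
    and dot_b_v: "dot b v = 1"
begin

definition G :: "(3 \<Rightarrow> 'r) \<Rightarrow> 'r" where
  "G y = (\<Prod>k\<in>I. dot (a k) y)"

definition dG :: "(3 \<Rightarrow> 'r) \<Rightarrow> 3 \<Rightarrow> 'r" where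
  "dG y = (\<lambda>j. \<Sum>k\<in>I. a k j * (\<Prod>l\<in>I - {k}. dot (a l) y))"

definition polar :: "(3 \<Rightarrow> 'r) \<Rightarrow> 3 \<Rightarrow> 'r" where
  "polar y = (\<lambda>j. dot b y * dG y j + G y * b j)"

definition polar_inv :: "(3 \<Rightarrow> 'r) \<Rightarrow> 3 \<Rightarrow> 'r" where
  "polar_inv w = (\<lambda>j. dot w v * cross b (dG (cross b w)) j + G (cross b w) * v j)"

text \<open>Multiplying the \<open>k\<close>-th summand by \<open>dot y (a k)\<close> restores the
  full product, so the sum is \<open>card I\<close> times \<open>G y\<close>. This is where the
  divisibility by the characteristic enters.\<close>

lemma euler: "dot y (dG y) = 0"
proof -
  have "dot y (dG y) = (\<Sum>k\<in>I. dot y (a k) * (\<Prod>l\<in>I - {k}. dot (a l) y))"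
    by (simp add: dG_def dot_sum dot_linear)
  also have "\<dots> = (\<Sum>k\<in>I. G y)"
    unfolding G_def by (intro sum.cong refl) (simp add: prod.remove[OF finite_I] dot_commute)
  finally show ?thesis by (simp add: of_nat_card)
qed

lemma dot_v_dG: "dot v (dG y) = 0"
proof -
  have "dot v (dG y) = (\<Sum>k\<in>I. dot v (a k) * (\<Prod>l\<in>I - {k}. dot (a l) y))"
    by (simp add: dG_def dot_sum dot_linear)
  then show ?thesis by (simp add: dot_commute[of v] dot_a_v)
qed

text \<open>\<open>G\<close> sees its argument only through the forms, with degree
  \<open>card I\<close>. The ratio \<gamma>/\<delta> is cross-multiplied, and multiples of
  \<open>v\<close> are invisible.\<close>

lemma G_scale:
  assumes "\<And>k. k \<in> I \<Longrightarrow> \<delta> * dot (a k) z = \<gamma> * dot (a k) y"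
  shows "\<delta> ^ card I * G z = \<gamma> ^ card I * G y"
  unfolding G_def prod_constant[symmetric] prod.distrib[symmetric]
  by (intro prod.cong refl assms)

lemma dG_scale:
  assumes "\<And>k. k \<in> I \<Longrightarrow> \<delta> * dot (a k) z = \<gamma> * dot (a k) y"
  shows "\<delta> ^ (card I - 1) * dG z j = \<gamma> ^ (card I - 1) * dG y j"
  unfolding dG_def sum_distrib_left
proof (intro sum.cong refl)
  fix k assume "k \<in> I"
  then have card: "card I - 1 = card (I - {k})"
    by simp
  have "\<delta> ^ (card I - 1) * (\<Prod>l\<in>I - {k}. dot (a l) z) =
      \<gamma> ^ (card I - 1) * (\<Prod>l\<in>I - {k}. dot (a l) y)"
    unfolding card prod_constant[symmetric] prod.distrib[symmetric]
    by (intro prod.cong refl assms) simp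
  then show "\<delta> ^ (card I - 1) * (a k j * (\<Prod>l\<in>I - {k}. dot (a l) z)) =
      \<gamma> ^ (card I - 1) * (a k j * (\<Prod>l\<in>I - {k}. dot (a l) y))"
    by (simp add: ac_simps)
qed

text \<open>Since \<open>dG y\<close> is orthogonal to \<open>v\<close> and
  \<open>dot b v = 1\<close>, crossing with \<open>v\<close> undoes crossing with \<open>b\<close>
  up to sign.\<close>

lemma dG_eq: "dG y j = - cross v (cross b (dG y)) j"
  by (simp add: cross_cross_right dot_v_dG dot_commute[of v b] dot_b_v)

text \<open>Being orthogonal to \<open>y\<close> and \<open>v\<close>, the gradient has the
  direction of \<open>cross y v\<close>; and \<open>cross b (cross y v)\<close> expands to
  \<open>y - dot b y * v\<close>.\<close>

lemma cross_b_dG_parallel: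
  "cross b (dG y) j * (y i - dot b y * v i) = cross b (dG y) i * (y j - dot b y * v j)"
proof -
  have "\<forall>i. cross (cross b (dG y)) (cross b (cross y v)) i = 0"
    by (simp add: cross_cross_cross dot_commute[of "dG y"] euler dot_v_dG)
  then show ?thesis
    unfolding cross_eq_0_iff by (simp add: cross_cross_right dot_b_v mult.commute)
qed

section \<open>The two composites of the polar map and its inverse\<close>

lemma power_card: "x ^ card I = x * x ^ (card I - 1)"
  using finite_I I_nonempty by (cases "card I") auto

text \<open>Component \<open>i\<close> of the parallel vectors \<open>cross b (dG y)\<close> and
  \<open>y - dot b y * v\<close> gives their ratio \<open>c / d\<close>. The power of
  \<open>d\<close> clears the denominators.\<close>

lemma polar_inv_polar:
  fixes y i
  defines "d \<equiv> y i - dot b y * v i" and "c \<equiv> cross b (dG y) i"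
  shows "d ^ card I * polar_inv (polar y) j =
    (dot b y * c) ^ (card I - 1) * c * G y * y j"
proof -
  define z where "z = cross b (polar y)"
  \<comment> \<open>Crossing with \<open>b\<close> kills the summand \<open>G y * b\<close> of the
    polar map.\<close>
  have z: "z j = dot b y * cross b (dG y) j" for j
    by (simp add: z_def polar_def cross_def algebra_simps)
  have par: "d * cross b (dG y) j = c * (y j - dot b y * v j)" for j
    using cross_b_dG_parallel[of y j i] by (simp add: c_def d_def ac_simps)
  have dot_z: "d * dot (a k) z = dot b y * c * dot (a k) y" if "k \<in> I" for k
  proof -
    have "d * dot (a k) z = dot b y * dot (a k) (\<lambda>j. d * cross b (dG y) j)"
      by (simp add: dot_scale z[abs_def])
    also have "\<dots> = dot b y * dot (a k) (\<lambda>j. c * (y j - dot b y * v j))"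
      by (simp only: par)
    also have "\<dots> = dot b y * c * dot (a k) y"
      using that by (simp add: dot_linear dot_a_v)
    finally show ?thesis .
  qed
  have scale: "d ^ card I * G z = (dot b y * c) ^ card I * G y"
    "d ^ (card I - 1) * dG z j = (dot b y * c) ^ (card I - 1) * dG y j" for j
    by (rule G_scale dG_scale, erule dot_z)+
  have dot_polar: "dot (polar y) v = G y"
    by (simp add: dot_commute[of "polar y"]) (simp add: polar_def dot_linear dot_v_dG dot_commute[of v b] dot_b_v)
  have "d ^ (card I - 1) * cross b (dG z) j = (dot b y * c) ^ (card I - 1) * cross b (dG y) j"
    by (simp only: scale flip: cross_scale)
  then have "d ^ card I * polar_inv (polar y) j =
      (dot b y * c) ^ (card I - 1) * G y * (d * cross b (dG y) j) + (dot b y * c) ^ card I * G y * v j"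
    using scale(1)
    unfolding polar_inv_def dot_polar z_def[symmetric]
    by (simp add: distrib_left power_card) (simp add: algebra_simps)
  \<comment> \<open>The multiple of \<open>v\<close> produced by \<open>par\<close> cancels the last
    summand.\<close>
  also have "\<dots> = (dot b y * c) ^ (card I - 1) * c * G y * y j"
    unfolding par by (simp add: power_card algebra_simps)
  finally show ?thesis .
qed

text \<open>Here \<open>y = cross b w\<close> is orthogonal to \<open>b\<close>, so
  \<open>cross b (dG y)\<close> is parallel to \<open>y\<close> itself, again with ratio
  \<open>c / d\<close>.\<close>

lemma polar_polar_inv:
  fixes w i
  defines "y \<equiv> cross b w"
  defines "d \<equiv> y i" and "c \<equiv> cross b (dG y) i"
  shows "d ^ card I * polar (polar_inv w) j =
    (dot w v * c) ^ (card I - 1) * c * G y * w j"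
proof -
  define z where "z = polar_inv w"
  have b_y: "dot b y = 0"
    by (simp add: y_def dot_cross_self)
  have par: "d * cross b (dG y) j = c * y j" for j
    using cross_b_dG_parallel[of y j i] by (simp add: c_def d_def ac_simps b_y)
  have dot_z: "d * dot (a k) z = dot w v * c * dot (a k) y" if "k \<in> I" for k
  proof -
    have "d * dot (a k) z = dot w v * dot (a k) (\<lambda>j. d * cross b (dG y) j)"
      using that by (simp add: z_def polar_inv_def y_def dot_linear dot_a_v)
    also have "\<dots> = dot w v * c * dot (a k) y"
      by (simp add: par dot_scale)
    finally show ?thesis .
  qed
  have scale: "d ^ card I * G z = (dot w v * c) ^ card I * G y"
    "d ^ (card I - 1) * dG z j = (dot w v * c) ^ (card I - 1) * dG y j" for j
    by (rule G_scale dG_scale, erule dot_z)+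
  have b_z: "dot b z = G y"
    by (simp add: z_def polar_inv_def y_def dot_linear dot_cross_self dot_b_v)
  \<comment> \<open>\<open>par\<close> replaces the inner vector by \<open>c\<close> times
    \<open>y = cross b w\<close>, and \<open>cross v (cross b w)\<close> expands to a multiple of
    \<open>b\<close> minus \<open>w\<close>.\<close>
  have "d * dG y j = - cross v (\<lambda>j. d * cross b (dG y) j) j"
    using dG_eq[of y j] by (simp add: cross_scale)
  also have "\<dots> = c * (w j - dot w v * b j)"
    unfolding par by (simp add: cross_scale y_def cross_cross_right dot_commute[of v] dot_b_v algebra_simps)
  finally have grad: "d * dG y j = c * (w j - dot w v * b j)" .
  have "d ^ card I * polar z j =
      G y * d * (d ^ (card I - 1) * dG z j) + d ^ card I * G z * b j"
    by (simp add: polar_def b_z power_card algebra_simps)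
  also have "\<dots> = G y * (dot w v * c) ^ (card I - 1) * (d * dG y j) + (dot w v * c) ^ card I * G y * b j"
    unfolding scale by (simp add: ac_simps)
  \<comment> \<open>The last summand restores exactly the multiple of \<open>b\<close> that is
    missing in \<open>grad\<close>.\<close>
  also have "\<dots> = (dot w v * c) ^ (card I - 1) * c * G y * w j"
    unfolding grad by (simp add: power_card algebra_simps)
  finally show ?thesis
    by (simp add: z_def)
qed

lemma dG_translate:
  assumes "\<And>k. k \<in> I \<Longrightarrow> dot (a k) z = dot (a k) y"
  shows "dG z j = dG y j"
  using dG_scale[of 1 z 1 y] assms by simp

end

section \<open>Evaluation homomorphisms\<close>

lemma poly_mapping_eq_sum_single:
  "f = (\<Sum>m\<in>Poly_Mapping.keys f. Poly_Mapping.single m (Poly_Mapping.lookup f m))"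
  by (rule poly_mapping_eqI) (simp add: lookup_sum lookup_single when_def in_keys_iff)

lemma poly_mapping_single_induct [case_names single add]:
  fixes f :: "'b \<Rightarrow>\<^sub>0 'a::comm_monoid_add"
  assumes "\<And>m c. P (Poly_Mapping.single m c)" "\<And>f g. P f \<Longrightarrow> P g \<Longrightarrow> P (f + g)"
  shows "P f"
proof -
  have "P 0"
    using assms(1)[of _ 0] by simp
  then have "P (\<Sum>m\<in>A. Poly_Mapping.single m (Poly_Mapping.lookup f m))" for A
    by (induction A rule: infinite_finite_induct) (simp_all add: assms)
  from this[of "Poly_Mapping.keys f"] show ?thesis
    by (simp only: poly_mapping_eq_sum_single[symmetric])
qed

text \<open>Point evaluation, substitution and the degree-counting substitution are all instances,
  so the homomorphism laws are proved once.\<close>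

definition insertion :: "('a::comm_ring_1 \<Rightarrow> 'b::comm_ring_1) \<Rightarrow> (3 \<Rightarrow> 'b) \<Rightarrow> 'a poly3 \<Rightarrow> 'b" where
  "insertion \<phi> y f = (\<Sum>m\<in>Poly_Mapping.keys f.
     \<phi> (Poly_Mapping.lookup f m) * (\<Prod>i\<in>UNIV. y i ^ Poly_Mapping.lookup m i))"

locale cring_hom =
  fixes \<phi> :: "'a::comm_ring_1 \<Rightarrow> 'b::comm_ring_1"
  assumes hom_one: "\<phi> 1 = 1" and hom_add: "\<phi> (x + y) = \<phi> x + \<phi> y" and hom_mult: "\<phi> (x * y) = \<phi> x * \<phi> y"
begin

lemma hom_zero: "\<phi> 0 = 0"
  using hom_add[of 0 0] by simp

lemma hom_uminus: "\<phi> (- x) = - \<phi> x"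
  using hom_add[of x "- x"] by (simp add: hom_zero eq_neg_iff_add_eq_0 add.commute)

lemma hom_diff: "\<phi> (x - y) = \<phi> x - \<phi> y"
  using hom_add[of x "- y"] by (simp add: hom_uminus)

lemma hom_sum: "\<phi> (\<Sum>i\<in>A. g i) = (\<Sum>i\<in>A. \<phi> (g i))"
  by (induction A rule: infinite_finite_induct) (auto simp: hom_zero hom_add)

lemma hom_prod: "\<phi> (\<Prod>i\<in>A. g i) = (\<Prod>i\<in>A. \<phi> (g i))"
  by (induction A rule: infinite_finite_induct) (auto simp: hom_one hom_mult)

lemma hom_dvd: "x dvd y \<Longrightarrow> \<phi> x dvd \<phi> y"
  by (auto simp: hom_mult)

lemma hom_dot: "\<phi> (dot u v) = dot (\<lambda>i. \<phi> (u i)) (\<lambda>i. \<phi> (v i))"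
  by (simp add: dot_def hom_sum hom_mult)

lemma hom_cross: "\<phi> (cross u v i) = cross (\<lambda>i. \<phi> (u i)) (\<lambda>i. \<phi> (v i)) i"
  by (simp add: cross_def hom_diff hom_mult)

lemma insertion_single: "insertion \<phi> y (Poly_Mapping.single m c) = \<phi> c * (\<Prod>i\<in>UNIV. y i ^ Poly_Mapping.lookup m i)"
  by (simp add: insertion_def hom_zero)

lemma insertion_add: "insertion \<phi> y (f + g) = insertion \<phi> y f + insertion \<phi> y g"
  unfolding insertion_def by (rule setsum_keys_plus_distrib) (simp_all add: hom_zero hom_add distrib_right)

lemma insertion_mult: "insertion \<phi> y (f * g) = insertion \<phi> y f * insertion \<phi> y g"
proof (induction f rule: poly_mapping_single_induct)
  case (single m c)
  show ?case
    by (induction g rule: poly_mapping_single_induct)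
      (simp_all add: mult_single insertion_single insertion_add hom_mult lookup_add power_add
        prod.distrib algebra_simps)
qed (simp add: insertion_add distrib_right)

lemma insertion_const: "insertion \<phi> y (Poly_Mapping.single 0 c) = \<phi> c"
  by (simp add: insertion_single)

lemma insertion_coord: "insertion \<phi> y (coord i) = y i"
proof -
  have "(\<Prod>j\<in>UNIV. y j ^ Poly_Mapping.lookup (Poly_Mapping.single i 1) j) = (\<Prod>j\<in>UNIV. if j = i then y j else 1)"
    by (intro prod.cong refl) (simp add: lookup_single when_def)
  then show ?thesis
    by (simp add: coord_def insertion_single hom_one)
qed

lemma insertion_hom: "cring_hom (insertion \<phi> y)"
proof
  show "insertion \<phi> y 1 = 1"
    using insertion_const[of y 1] by (simp add: hom_one)
qed (simp_all add: insertion_add insertion_mult)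

end

lemma cring_hom_const: "cring_hom (Poly_Mapping.single (0 :: mono3) :: 'a::comm_ring_1 \<Rightarrow> _)"
  by standard (simp_all add: single_add mult_single)

lemma cring_hom_id: "cring_hom (\<lambda>x :: 'a::comm_ring_1. x)"
  by standard simp_all

abbreviation const :: "'a::comm_ring_1 \<Rightarrow> 'a poly3" where
  "const \<equiv> Poly_Mapping.single 0"

interpretation const: cring_hom "const :: 'a::comm_ring_1 \<Rightarrow> 'a poly3"
  by (rule cring_hom_const)

lemma subst3_eq_insertion: "subst3 f y = insertion const y f"
  by (simp add: subst3_def insertion_def)

lemma eval3_eq_insertion: "eval3 f u = insertion (\<lambda>x. x) (($) u) f"
  by (simp add: eval3_def insertion_def)

interpretation subst: cring_hom "\<lambda>f. subst3 f y" for y :: "3 \<Rightarrow> 'a::comm_ring_1 poly3"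
  unfolding subst3_eq_insertion by (rule const.insertion_hom)

interpretation eval: cring_hom "\<lambda>f. eval3 f u" for u :: "'a::comm_ring_1 ^ 3"
  unfolding eval3_eq_insertion by (rule cring_hom.insertion_hom[OF cring_hom_id])

lemma subst3_const: "subst3 (const c) y = const c"
  by (simp add: subst3_eq_insertion const.insertion_const)

lemma subst3_coord: "subst3 (coord i) y = y i"
  by (simp add: subst3_eq_insertion const.insertion_coord)

lemma eval3_const: "eval3 (const c) u = c"
  by (simp add: eval3_eq_insertion cring_hom.insertion_const[OF cring_hom_id])

lemma eval3_coord: "eval3 (coord i) u = u $ i"
  by (simp add: eval3_eq_insertion cring_hom.insertion_coord[OF cring_hom_id])

section \<open>Monomials as products of coordinates\<close>

lemma coord_power: "coord i ^ k = (Poly_Mapping.single (Poly_Mapping.single i k) 1 :: 'a::comm_ring_1 poly3)"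
  by (induction k) (simp_all add: coord_def mult_single add.commute flip: single_add)

lemma prod_single_one:
  "(\<Prod>i\<in>A. Poly_Mapping.single (g i) 1) = (Poly_Mapping.single (\<Sum>i\<in>A. g i) 1 :: 'a::comm_ring_1 poly3)"
  by (induction A rule: infinite_finite_induct) (simp_all add: mult_single)

lemma prod_coord_power:
  "(\<Prod>i\<in>UNIV. coord i ^ Poly_Mapping.lookup m i) = (Poly_Mapping.single m 1 :: 'a::comm_ring_1 poly3)"
proof -
  have "(\<Sum>i\<in>UNIV. Poly_Mapping.single i (Poly_Mapping.lookup m i)) = m"
    by (rule poly_mapping_eqI) (simp add: lookup_sum lookup_single when_def)
  then show ?thesis
    by (simp add: coord_power prod_single_one)
qed

lemma subst3_coord_id: "subst3 f coord = f"
  by (simp add: subst3_def prod_coord_power mult_single flip: poly_mapping_eq_sum_single)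

text \<open>Congruence modulo \<open>q\<close> is compatible with the ring operations; by additivity
  it suffices to treat monomials.\<close>

lemma dvd_diff_subst3:
  fixes q :: "'a::comm_ring_1 poly3"
  assumes "\<And>i. q dvd y i - z i"
  shows "q dvd subst3 f y - subst3 f z"
proof (induction f rule: poly_mapping_single_induct)
  case (single m c)
  have pow: "q dvd y i ^ k - z i ^ k" for i k
    unfolding power_diff_sumr2 by (rule dvd_mult2[OF assms])
  have "q dvd (\<Prod>i\<in>A. y i ^ k i) - (\<Prod>i\<in>A. z i ^ k i)" for A and k :: "3 \<Rightarrow> nat"
  proof (induction A rule: infinite_finite_induct)
    case (insert i A)
    \<comment> \<open>Exchanging one factor at a time makes the difference of products
      telescope.\<close>
    have "y i ^ k i * (\<Prod>i\<in>A. y i ^ k i) - z i ^ k i * (\<Prod>i\<in>A. z i ^ k i) =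
      (y i ^ k i - z i ^ k i) * (\<Prod>i\<in>A. y i ^ k i) +
      z i ^ k i * ((\<Prod>i\<in>A. y i ^ k i) - (\<Prod>i\<in>A. z i ^ k i))"
      by (simp add: algebra_simps)
    then show ?case
      using insert pow by (auto intro!: dvd_add)
  qed simp_all
  then show ?case
    by (simp add: subst3_eq_insertion const.insertion_single flip: right_diff_distrib)
next
  case (add f g)
  then show ?case
    using dvd_add[OF add] by (simp add: subst.hom_add algebra_simps)
qed

section \<open>Degrees\<close>

lemma mono_degree_add: "mono_degree (m + m') = mono_degree m + mono_degree m'"
  by (simp add: mono_degree_def lookup_add sum.distrib)

lemma mono_degree_single: "mono_degree (Poly_Mapping.single i k) = k"
  by (simp add: mono_degree_def lookup_single when_def)

lemma homogeneous_zero: "homogeneous d 0"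
  by (simp add: homogeneous_def)

lemma homogeneous_const: "homogeneous 0 (const c)"
  by (simp add: homogeneous_def mono_degree_def)

lemma homogeneous_coord: "homogeneous 1 (coord i)"
  by (simp add: homogeneous_def coord_def mono_degree_single)

lemma homogeneous_add: "homogeneous d f \<Longrightarrow> homogeneous d g \<Longrightarrow> homogeneous d (f + g)"
  using keys_add[of f g] by (auto simp: homogeneous_def)

lemma homogeneous_sum: "(\<And>i. i \<in> A \<Longrightarrow> homogeneous d (g i)) \<Longrightarrow> homogeneous d (\<Sum>i\<in>A. g i)"
  by (induction A rule: infinite_finite_induct) (auto simp: homogeneous_zero homogeneous_add)

lemma homogeneous_diff:
  fixes f g :: "'a::ab_group_add poly3"
  shows "homogeneous d f \<Longrightarrow> homogeneous d g \<Longrightarrow> homogeneous d (f - g)"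
  unfolding homogeneous_def by (metis (no_types) in_keys_iff lookup_minus diff_self)

lemma homogeneous_mult:
  "homogeneous d f \<Longrightarrow> homogeneous e g \<Longrightarrow> homogeneous (d + e) (f * g)"
  using keys_mult[of f g] by (fastforce simp: homogeneous_def mono_degree_add)

lemma homogeneous_prod:
  fixes g :: "'i \<Rightarrow> 'a::comm_ring_1 poly3"
  shows "(\<And>i. i \<in> A \<Longrightarrow> homogeneous (e i) (g i)) \<Longrightarrow> homogeneous (\<Sum>i\<in>A. e i) (\<Prod>i\<in>A. g i)"
  using homogeneous_const[of 1]
  by (induction A rule: infinite_finite_induct) (auto simp: homogeneous_mult)

lemma homogeneous_power:
  fixes f :: "'a::comm_ring_1 poly3"
  shows "homogeneous d f \<Longrightarrow> homogeneous (d * k) (f ^ k)"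
  using homogeneous_const[of 1]
  by (induction k) (auto simp: homogeneous_mult)

lemma homogeneous_subst3:
  assumes "homogeneous d f" "\<And>i. homogeneous e (y i)"
  shows "homogeneous (e * d) (subst3 f y)"
  unfolding subst3_def
proof (rule homogeneous_sum)
  fix m assume "m \<in> Poly_Mapping.keys f"
  then have "e * d = 0 + (\<Sum>i\<in>UNIV. e * Poly_Mapping.lookup m i)"
    using assms(1) by (auto simp: homogeneous_def mono_degree_def sum_distrib_left)
  also have "homogeneous \<dots> (const (Poly_Mapping.lookup f m) * (\<Prod>i\<in>UNIV. y i ^ Poly_Mapping.lookup m i))"
    by (intro homogeneous_mult homogeneous_const homogeneous_prod homogeneous_power assms)
  finally show "homogeneous (e * d) (const (Poly_Mapping.lookup f m) * (\<Prod>i\<in>UNIV. y i ^ Poly_Mapping.lookup m i))" .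
qed

text \<open>The substitution \<open>x\<^sub>i \<mapsto> t x\<^sub>i\<close> turns the total degree into the degree in \<open>t\<close>, which is
  additive under multiplication.\<close>

lemma total_degree_unit:
  fixes h :: "'a::field poly3"
  assumes "h dvd 1"
  shows "total_degree h = 0"
proof -
  interpret C: cring_hom "\<lambda>c :: 'a. [:const c:]"
    by standard (simp_all add: single_add mult_single mult.commute flip: one_pCons)
  \<comment> \<open>The polynomial variable plays the role of \<open>t\<close>; the coefficients are
    again polynomials in the three coordinates.\<close>
  let ?D = "insertion (\<lambda>c :: 'a. [:const c:]) (\<lambda>i. monom (coord i) 1)"
  interpret D: cring_hom ?D
    by (rule C.insertion_hom)
  have "?D h dvd 1"
    using D.hom_dvd[OF assms] by (simp only: D.hom_one)
  then have degree_D: "degree (?D h) = 0"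
    by (auto simp: is_unit_poly_iff)
  have prod_monom: "(\<Prod>i\<in>A. monom (g i) (k i)) = monom (\<Prod>i\<in>A. g i) (\<Sum>i\<in>A. k i)"
    for A and g :: "3 \<Rightarrow> 'a poly3" and k
    by (induction A rule: infinite_finite_induct) (simp_all add: mult_monom flip: one_pCons monom_0)
  have D: "?D h = (\<Sum>m\<in>Poly_Mapping.keys h. monom (Poly_Mapping.single m (Poly_Mapping.lookup h m)) (mono_degree m))"
    by (simp add: insertion_def monom_power prod_monom prod_coord_power mono_degree_def
        smult_monom mult_single)
  have "mono_degree m = 0" if "m \<in> Poly_Mapping.keys h" for m
  proof (rule ccontr)
    assume "mono_degree m \<noteq> 0"
    \<comment> \<open>This coefficient is the homogeneous part of \<open>h\<close> in the degree of
      \<open>m\<close>, so it still contains the monomial \<open>m\<close>.\<close>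
    then have "coeff (?D h) (mono_degree m) = 0"
      by (intro coeff_eq_0) (simp only: degree_D neq0_conv)
    then have "0 = Poly_Mapping.lookup (coeff (?D h) (mono_degree m)) m"
      by simp
    also have "\<dots> = (\<Sum>m'\<in>Poly_Mapping.keys h. if m' = m then Poly_Mapping.lookup h m else 0)"
      unfolding D coeff_sum lookup_sum by (intro sum.cong refl) (auto simp: lookup_single when_def)
    finally show False
      using that by (simp add: in_keys_iff)
  qed
  then show ?thesis
    by (auto simp: total_degree_def intro!: Max_eqI)
qed

section \<open>Linear forms\<close>

definition lin_form :: "(3 \<Rightarrow> 'a::comm_ring_1) \<Rightarrow> 'a poly3" where
  "lin_form a = dot (\<lambda>i. const (a i)) coord"

lemma homogeneous_lin_form: "homogeneous 1 (lin_form a)"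
  unfolding lin_form_def dot_def
  using homogeneous_mult[OF homogeneous_const homogeneous_coord]
  by (intro homogeneous_sum) simp

lemma subst3_lin_form: "subst3 (lin_form a) y = dot (\<lambda>i. const (a i)) y"
  by (simp add: lin_form_def subst.hom_dot subst3_const subst3_coord)

lemma eval3_lin_form: "eval3 (lin_form a) u = dot a (($) u)"
  by (simp add: lin_form_def eval.hom_dot eval3_const eval3_coord)

lemma mono_degree_1E:
  assumes "mono_degree m = 1"
  obtains i where "m = Poly_Mapping.single i 1"
proof -
  from assms obtain i where i: "Poly_Mapping.lookup m i \<noteq> 0"
    by (force simp: mono_degree_def)
  have "mono_degree m = Poly_Mapping.lookup m i + (\<Sum>j\<in>UNIV - {i}. Poly_Mapping.lookup m j)"
    by (simp add: mono_degree_def sum.remove[of UNIV i])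
  with assms i have "Poly_Mapping.lookup m i = 1" "(\<Sum>j\<in>UNIV - {i}. Poly_Mapping.lookup m j) = 0"
    by linarith+
  then have "m = Poly_Mapping.single i 1"
    by (intro poly_mapping_eqI) (auto simp: lookup_single when_def)
  then show ?thesis ..
qed

lemma single_index_eq_iff:
  "k \<noteq> 0 \<Longrightarrow> Poly_Mapping.single j k = Poly_Mapping.single i k \<longleftrightarrow> j = i"
  by (metis lookup_single_eq lookup_single_not_eq)

lemma lookup_lin_form: "Poly_Mapping.lookup (lin_form a) (Poly_Mapping.single i 1) = a i"
proof -
  have "Poly_Mapping.lookup (const (a j) * coord j) (Poly_Mapping.single i 1) = (if j = i then a j else 0)" for j
    by (cases "j = i")
      (simp_all add: coord_def mult_single lookup_single when_def single_index_eq_iff)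
  then show ?thesis
    by (simp add: lin_form_def dot_def lookup_sum)
qed

lemma homogeneous_1E:
  assumes "homogeneous 1 l"
  obtains a where "l = lin_form a"
proof
  define a where "a i = Poly_Mapping.lookup l (Poly_Mapping.single i 1)" for i
  have "Poly_Mapping.lookup l m = Poly_Mapping.lookup (lin_form a) m" for m
  proof (cases "mono_degree m = 1")
    case True
    then obtain i where "m = Poly_Mapping.single i 1"
      by (rule mono_degree_1E)
    then show ?thesis
      by (simp only: lookup_lin_form a_def)
  next
    case False
    then have "m \<notin> Poly_Mapping.keys l" "m \<notin> Poly_Mapping.keys (lin_form a)"
      using assms homogeneous_lin_form[of a] by (auto simp: homogeneous_def)
    then show ?thesis
      by (simp add: in_keys_iff)
  qed
  then show "l = lin_form a"
    by (rule poly_mapping_eqI)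
qed

text \<open>Eliminating a variable is a ring endomorphism whose kernel is generated by the linear form.\<close>

lemma lin_form_kernel:
  fixes a :: "3 \<Rightarrow> 'a::field"
  assumes "a i \<noteq> 0"
  obtains y where "\<And>f. lin_form a dvd f \<longleftrightarrow> subst3 f y = 0"
proof
  \<comment> \<open>The \<open>i\<close>-th coordinate is replaced by its solution from
    \<open>lin_form a = 0\<close>; the others stay.\<close>
  define y where "y j = coord j - (if j = i then const (1 / a i) * lin_form a else 0)" for j
  have "dot (\<lambda>i. const (a i)) (\<lambda>j. if j = i then const (1 / a i) * lin_form a else 0) = lin_form a"
    using assms by (simp add: dot_def if_distrib cong: if_cong) (simp add: mult_single flip: mult.assoc)
  then have "subst3 (lin_form a) y = 0"
    by (simp add: subst3_lin_form y_def[abs_def] dot_diff) (simp add: lin_form_def)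
  \<comment> \<open>Every coordinate changes by a multiple of the form, so \<open>f\<close> is
    congruent to its substitution instance.\<close>
  moreover have "lin_form a dvd coord j - y j" for j
    by (simp add: y_def)
  then have "lin_form a dvd f - subst3 f y" for f
    using dvd_diff_subst3[of "lin_form a" coord y f] by (simp add: subst3_coord_id)
  ultimately show "lin_form a dvd f \<longleftrightarrow> subst3 f y = 0" for f
    by (metis diff_zero dvd_def mult_zero_left subst.hom_mult)
qed

text \<open>The form generates the kernel of a homomorphism into an integral domain, hence is
  prime.\<close>

lemma lin_form_dvd_mult:
  fixes a :: "3 \<Rightarrow> 'a::field"
  assumes "lin_form a dvd f * g" "a \<noteq> (\<lambda>_. 0)"
  shows "lin_form a dvd f \<or> lin_form a dvd g"
proof -
  from assms(2) obtain i where "a i \<noteq> 0" by auto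
  then show ?thesis
    using assms(1) by (elim lin_form_kernel) (simp add: subst.hom_mult)
qed

lemma lin_form_dvd_prod:
  fixes a :: "3 \<Rightarrow> 'a::field"
  assumes "lin_form a dvd (\<Prod>k\<in>A. g k)" "a \<noteq> (\<lambda>_. 0)" "finite A" "\<not> lin_form a dvd 1"
  shows "\<exists>k\<in>A. lin_form a dvd g k"
  using assms(3,1,4)
proof (induction A rule: finite_induct)
  case (insert k A)
  then show ?case
    using lin_form_dvd_mult[OF _ assms(2), of "g k" "\<Prod>k\<in>A. g k"] by auto
qed simp

text \<open>\<open>cross a e\<close> is a zero of the first form, hence of the second. Unit vectors
  \<open>e\<close> then read off the components of the cross product.\<close>

lemma lin_form_dvd_lin_form:
  fixes a b :: "3 \<Rightarrow> 'a::field"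
  assumes "lin_form a dvd lin_form b"
  shows "cross a b i = 0"
proof -
  have "dot b (cross a e) = 0" for e
  proof -
    have "eval3 (lin_form a) (\<chi> i. cross a e i) dvd eval3 (lin_form b) (\<chi> i. cross a e i)"
      using eval.hom_dvd[OF assms] .
    then show ?thesis
      by (simp add: eval3_lin_form dot_cross_self vec_lambda_inverse)
  qed
  from this[of "\<lambda>j. if j = i then 1 else 0"] show ?thesis
    by (simp add: dot_cross_rotate) (simp add: dot_def if_distrib cross_def algebra_simps cong: if_cong)
qed

lemma lin_form_not_unit:
  fixes a :: "3 \<Rightarrow> 'a::field"
  shows "\<not> lin_form a dvd 1"
  using eval.hom_dvd[of "lin_form a" 1 0] by (auto simp: eval3_lin_form dot_def eval.hom_one)

text \<open>Writing the product as \<open>h * g\<close>, each prime divides the cofactor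
  \<open>g\<close> and can be cancelled; in the end \<open>h\<close> divides 1.\<close>

lemma dvd_prod_primes_unit:
  fixes q :: "'i \<Rightarrow> 'a::idom"
  assumes "finite A" "h dvd (\<Prod>k\<in>A. q k)"
    and prime: "\<And>k f g. k \<in> A \<Longrightarrow> q k dvd f * g \<Longrightarrow> q k dvd f \<or> q k dvd g"
    and "\<And>k. k \<in> A \<Longrightarrow> q k \<noteq> 0" "\<And>k. k \<in> A \<Longrightarrow> \<not> q k dvd h"
  shows "h dvd 1"
  using assms
proof (induction A rule: finite_induct)
  case (insert k A)
  from insert.prems(1) obtain g where g: "q k * (\<Prod>k\<in>A. q k) = h * g"
    using insert.hyps by (auto simp: dvd_def)
  then have "q k dvd h * g"
    by (metis dvd_triv_left)
  then have "q k dvd g"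
    using insert.prems(2,4) by blast
  then obtain g' where "g = q k * g'"
    by (auto simp: dvd_def)
  with g have "q k * (\<Prod>k\<in>A. q k) = q k * (h * g')"
    by (simp add: ac_simps)
  then have "h dvd (\<Prod>k\<in>A. q k)"
    using insert.prems(3) by auto
  then show ?case
    using insert.IH insert.prems(2-4) by blast
qed simp

section \<open>Partial derivatives\<close>

lemma partial3_single:
  "partial3 i (Poly_Mapping.single m c) =
    Poly_Mapping.single (m - Poly_Mapping.single i 1) (of_nat (Poly_Mapping.lookup m i) * c)"
  by (simp add: partial3_def)

lemma partial3_add: "partial3 i (f + g) = partial3 i f + partial3 i g"
  unfolding partial3_def
  by (rule setsum_keys_plus_distrib) (simp_all add: distrib_left single_add)

lemma partial3_mult: "partial3 i (f * g) = partial3 i f * g + f * partial3 i g"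
proof (induction f rule: poly_mapping_single_induct)
  case (single m c)
  show ?case
  proof (induction g rule: poly_mapping_single_induct)
    case (single m' c')
    let ?e = "Poly_Mapping.single i 1"
    \<comment> \<open>With truncated subtraction the shift may fail if \<open>m\<close> does not
      involve the variable \<open>i\<close>, but then the coefficient is zero.\<close>
    have shift: "m + m' - ?e = m - ?e + m'" if "Poly_Mapping.lookup m i \<noteq> 0" for m m' :: mono3
      using that by (intro poly_mapping_eqI) (auto simp: lookup_add lookup_minus lookup_single when_def)
    have *: "Poly_Mapping.single (m + m' - ?e) (of_nat (Poly_Mapping.lookup m i) * x) =
        Poly_Mapping.single (m - ?e + m') (of_nat (Poly_Mapping.lookup m i) * x)" for m m' and x :: 'a
      using shift[of m m'] by (cases "Poly_Mapping.lookup m i = 0") simp_all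
    have "partial3 i (Poly_Mapping.single m c * Poly_Mapping.single m' c') =
        Poly_Mapping.single (m + m' - ?e) (of_nat (Poly_Mapping.lookup m i) * (c * c')) +
        Poly_Mapping.single (m' + m - ?e) (of_nat (Poly_Mapping.lookup m' i) * (c * c'))"
      by (simp only: mult_single partial3_single lookup_add of_nat_add distrib_right single_add
          add.commute[of m' m])
    then show ?case
      unfolding * by (simp add: partial3_single mult_single ac_simps)
  qed (simp_all add: partial3_add algebra_simps)
qed (simp_all add: partial3_add algebra_simps)

lemma partial3_const: "partial3 i (const c) = 0"
  by (simp add: partial3_single)

lemma partial3_coord: "partial3 i (coord j) = (if i = j then 1 else 0)"
  by (auto simp: coord_def partial3_single lookup_single when_def)

lemma partial3_sum: "partial3 i (\<Sum>k\<in>A. g k) = (\<Sum>k\<in>A. partial3 i (g k))"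
  using partial3_const[of i 0]
  by (induction A rule: infinite_finite_induct) (simp_all add: partial3_add)

lemma partial3_lin_form: "partial3 i (lin_form a) = const (a i)"
  by (simp add: lin_form_def dot_def partial3_sum partial3_mult partial3_const partial3_coord
      if_distrib cong: if_cong)

lemma partial3_prod:
  assumes "finite A"
  shows "partial3 i (\<Prod>k\<in>A. g k) = (\<Sum>k\<in>A. partial3 i (g k) * (\<Prod>l\<in>A - {k}. g l))"
  using assms
proof (induction A rule: finite_induct)
  case empty
  show ?case
    using partial3_const[of i 1] by simp
next
  case (insert k A)
  have "(\<Prod>l\<in>insert k A - {j}. g l) = g k * (\<Prod>l\<in>A - {j}. g l)" if "j \<in> A" for j
  proof -
    have "insert k A - {j} = insert k (A - {j})"
      using that insert.hyps by auto
    then show ?thesis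
      using insert.hyps by simp
  qed
  then show ?case
    using insert by (simp add: partial3_mult sum_distrib_left ac_simps)
qed

section \<open>Homogeneity of dot and cross products\<close>

lemma homogeneous_dot:
  fixes u w :: "3 \<Rightarrow> 'a::comm_ring_1 poly3"
  assumes "\<And>i. homogeneous d (u i)" "\<And>i. homogeneous e (w i)"
  shows "homogeneous (d + e) (dot u w)"
  unfolding dot_def by (intro homogeneous_sum homogeneous_mult assms)

lemma homogeneous_cross:
  fixes u w :: "3 \<Rightarrow> 'a::comm_ring_1 poly3"
  assumes "\<And>i. homogeneous d (u i)" "\<And>i. homogeneous e (w i)"
  shows "homogeneous (d + e) (cross u w i)"
  unfolding cross_def by (intro homogeneous_diff homogeneous_mult assms)

lemma lin_form_eq_0_iff: "lin_form a = 0 \<longleftrightarrow> a = (\<lambda>_. 0)"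
proof
  assume "lin_form a = 0"
  then have "eval3 (lin_form a) (axis i 1) = 0" for i
    by (simp add: eval.hom_zero)
  moreover have "eval3 (lin_form a) (axis i 1) = a i" for i
    by (simp add: eval3_lin_form dot_def axis_def if_distrib cong: if_cong)
  ultimately show "a = (\<lambda>_. 0)"
    by auto
qed (simp add: lin_form_def dot_def)

section \<open>Products of pairwise non-proportional linear forms\<close>

lemma dvd_prod_lin_form_unit:
  fixes a :: "'i \<Rightarrow> 3 \<Rightarrow> 'a::field"
  assumes "finite I" "\<And>k. k \<in> I \<Longrightarrow> a k \<noteq> (\<lambda>_. 0)"
    and "h dvd (\<Prod>k\<in>I. lin_form (a k))" "\<And>k. k \<in> I \<Longrightarrow> \<not> lin_form (a k) dvd h"
  shows "h dvd 1"
  using assms(1,3)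
proof (rule dvd_prod_primes_unit)
  show "lin_form (a k) dvd f \<or> lin_form (a k) dvd g"
    if "k \<in> I" "lin_form (a k) dvd f * g" for k f g
    using lin_form_dvd_mult[OF that(2) assms(2)[OF that(1)]] .
  show "lin_form (a k) \<noteq> 0" if "k \<in> I" for k
    using assms(2)[OF that] by (simp add: lin_form_eq_0_iff)
qed (rule assms(4))

text \<open>By primality the form would divide another factor and be proportional to it.\<close>

lemma lin_form_not_dvd_prod:
  fixes a :: "'i \<Rightarrow> 3 \<Rightarrow> 'a::field"
  assumes "finite I" "k \<in> I" "\<And>k. k \<in> I \<Longrightarrow> a k \<noteq> (\<lambda>_. 0)"
    and "\<And>k l. k \<in> I \<Longrightarrow> l \<in> I \<Longrightarrow> k \<noteq> l \<Longrightarrow> \<exists>i. cross (a k) (a l) i \<noteq> 0"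
  shows "\<not> lin_form (a k) dvd (\<Prod>l\<in>I - {k}. lin_form (a l))"
proof
  assume "lin_form (a k) dvd (\<Prod>l\<in>I - {k}. lin_form (a l))"
  then obtain l where "l \<in> I - {k}" "lin_form (a k) dvd lin_form (a l)"
    using lin_form_dvd_prod[OF _ assms(3)[OF assms(2)] _ lin_form_not_unit] assms(1) by blast
  then show False
    using lin_form_dvd_lin_form assms(2) assms(4)[of k l] by blast
qed

lemma squarefree_prod_lin_form:
  fixes a :: "'i \<Rightarrow> 3 \<Rightarrow> 'a::field"
  assumes "finite I" "\<And>k. k \<in> I \<Longrightarrow> a k \<noteq> (\<lambda>_. 0)"
    and "\<And>k l. k \<in> I \<Longrightarrow> l \<in> I \<Longrightarrow> k \<noteq> l \<Longrightarrow> \<exists>i. cross (a k) (a l) i \<noteq> 0"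
  shows "squarefree (\<Prod>k\<in>I. lin_form (a k))"
proof (rule squarefreeI)
  fix h assume h: "h ^ 2 dvd (\<Prod>k\<in>I. lin_form (a k))"
  \<comment> \<open>Otherwise the form would occur twice in the product; cancelling one copy leaves
    it dividing the remaining factors.\<close>
  have "\<not> lin_form (a k) dvd h" if k: "k \<in> I" for k
  proof
    assume "lin_form (a k) dvd h"
    then have "lin_form (a k) ^ 2 dvd (\<Prod>k\<in>I. lin_form (a k))"
      using h by (meson dvd_power_same dvd_trans)
    then have "lin_form (a k) * lin_form (a k) dvd lin_form (a k) * (\<Prod>l\<in>I - {k}. lin_form (a l))"
      by (simp only: power2_eq_square prod.remove[OF assms(1) k])
    then have "lin_form (a k) dvd (\<Prod>l\<in>I - {k}. lin_form (a l))"
      using assms(2)[OF k] by (simp add: lin_form_eq_0_iff)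
    moreover have "\<not> lin_form (a k) dvd (\<Prod>l\<in>I - {k}. lin_form (a l))"
      by (rule lin_form_not_dvd_prod[OF assms(1) k]) (use assms(2,3) in blast)+
    ultimately show False
      by contradiction
  qed
  moreover have "h dvd (\<Prod>k\<in>I. lin_form (a k))"
    using h by (metis dvd_mult_left power2_eq_square)
  ultimately show "h dvd 1"
    by (intro dvd_prod_lin_form_unit[OF assms(1,2)])
qed

section \<open>Near-pencils\<close>

text \<open>\<open>v\<close> represents the common point of the concurrent lines, scaled to give the
  form \<open>b\<close> of the further line the value 1. Nonzero cross products express that the
  concurrent lines are distinct.\<close>

locale near_pencil_forms =
  fixes I :: "'i set" and a :: "'i \<Rightarrow> 3 \<Rightarrow> 'a::field" and b v :: "3 \<Rightarrow> 'a"
  assumes finite: "finite I" and nonempty: "I \<noteq> {}"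
    and of_nat_card_eq_0: "of_nat (card I) = (0 :: 'a)"
    and dot_form_v: "k \<in> I \<Longrightarrow> dot (a k) v = 0" and dot_line_v: "dot b v = 1"
    and a_nonzero: "k \<in> I \<Longrightarrow> a k \<noteq> (\<lambda>_. 0)"
    and a_distinct: "k \<in> I \<Longrightarrow> l \<in> I \<Longrightarrow> k \<noteq> l \<Longrightarrow> \<exists>i. cross (a k) (a l) i \<noteq> 0"
begin

abbreviation "A \<equiv> \<lambda>k i. const (a k i)"
abbreviation "B \<equiv> \<lambda>i. const (b i)"
abbreviation "V \<equiv> \<lambda>i. const (v i)"

lemma dot_B_V: "dot B V = 1"
  using const.hom_dot[of b v] by (simp add: dot_line_v)

sublocale pencil_with_line I A B V
proof
  \<comment> \<open>Integers are constants in the polynomial ring, so the vanishing of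
    \<open>card I\<close> carries over from the field.\<close>
  show "of_nat (card I) = (0 :: 'a poly3)"
    using single_of_nat[of "card I", where ?'b = 'a and ?'a = mono3]
    by (simp add: of_nat_card_eq_0)
  show "dot (A k) V = 0" if "k \<in> I" for k
    using const.hom_dot[of "a k" v] dot_form_v[OF that] by simp
qed (simp_all add: finite nonempty dot_B_V)

definition equation :: "'a poly3" where
  "equation = (\<Prod>k\<in>I. lin_form (a k)) * lin_form b"

lemma dot_A_coord: "dot (A k) coord = lin_form (a k)"
  by (simp add: lin_form_def)

lemma dot_B_coord: "dot B coord = lin_form b"
  by (simp add: lin_form_def)

lemma G_coord: "G coord = (\<Prod>k\<in>I. lin_form (a k))"
  by (simp add: G_def dot_A_coord)

text \<open>The product rule identifies the formal expression \<open>polar\<close> with the actual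
  partial derivatives.\<close>

lemma polar_map_equation: "polar_map equation = polar coord"
  by (rule ext) (simp add: polar_map_def equation_def partial3_mult partial3_lin_form
      partial3_prod[OF finite] polar_def dG_def G_coord dot_A_coord dot_B_coord mult.commute)

lemma b_nonzero: "b \<noteq> (\<lambda>_. 0)" and v_nonzero: "v \<noteq> (\<lambda>_. 0)"
  using dot_line_v by (auto simp: dot_def)

text \<open>Crossing \<open>cross (a k) b\<close> with \<open>v\<close> gives \<open>- a k\<close>,
  which is nonzero.\<close>

lemma cross_form_line: "k \<in> I \<Longrightarrow> \<exists>i. cross (a k) b i \<noteq> 0"
proof (rule ccontr)
  assume k: "k \<in> I" and "\<not> (\<exists>i. cross (a k) b i \<noteq> 0)"
  then have "cross (cross (a k) b) v i = 0" for i
    by (simp add: cross_def)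
  then show False
    using a_nonzero[OF k] by (auto simp: cross_cross_left dot_form_v[OF k] dot_line_v)
qed

lemma squarefree_equation: "squarefree equation"
proof -
  \<comment> \<open>The index \<open>None\<close> stands for the further line, which makes the
    equation a single product of forms.\<close>
  define J where "J = insert None (Some ` I)"
  define c where "c = case_option b a"
  have "equation = (\<Prod>k\<in>J. lin_form (c k))"
    using finite by (simp add: equation_def J_def c_def prod.reindex mult.commute)
  also have "squarefree \<dots>"
  proof (rule squarefree_prod_lin_form)
    fix k l assume "k \<in> J" "l \<in> J" "k \<noteq> l"
    moreover have "\<exists>i. cross b (a k) i \<noteq> 0" if "k \<in> I" for k
      using cross_form_line[OF that] by (metis cross_commute neg_equal_0_iff_equal)
    ultimately show "\<exists>i. cross (c k) (c l) i \<noteq> 0"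
      using a_distinct cross_form_line by (cases k; cases l) (simp_all add: J_def c_def image_iff)
  qed (use finite a_nonzero b_nonzero in \<open>auto simp: J_def c_def\<close>)
  finally show ?thesis .
qed

text \<open>Modulo the \<open>k\<close>-th form only the \<open>k\<close>-th summand of the gradient
  survives. Where \<open>a k j\<close> is nonzero, it is a unit times the product of the other
  forms.\<close>

lemma form_not_dvd_gradient:
  assumes k: "k \<in> I"
  shows "\<exists>j. \<not> lin_form (a k) dvd dG coord j"
proof -
  from a_nonzero[OF k] obtain j where j: "a k j \<noteq> 0"
    by auto
  have "\<not> lin_form (a k) dvd dG coord j"
  proof
    assume "lin_form (a k) dvd dG coord j"
    also have "dG coord j = const (a k j) * (\<Prod>l\<in>I - {k}. lin_form (a l)) +
        (\<Sum>l\<in>I - {k}. const (a l j) * (\<Prod>m\<in>I - {l}. lin_form (a m)))"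
      by (simp add: dG_def dot_A_coord sum.remove[OF finite k])
    finally have "lin_form (a k) dvd const (a k j) * (\<Prod>l\<in>I - {k}. lin_form (a l))"
      by (subst (asm) dvd_add_left_iff) (use finite k in \<open>auto intro!: dvd_sum dvd_mult dvd_prodI\<close>)
    then have "lin_form (a k) dvd const (1 / a k j) * (const (a k j) * (\<Prod>l\<in>I - {k}. lin_form (a l)))"
      by (rule dvd_mult)
    then have "lin_form (a k) dvd (\<Prod>l\<in>I - {k}. lin_form (a l))"
      using j by (simp add: mult_single flip: mult.assoc)
    moreover have "\<not> lin_form (a k) dvd (\<Prod>l\<in>I - {k}. lin_form (a l))"
      by (rule lin_form_not_dvd_prod[OF finite k]) (use a_nonzero a_distinct in blast)+
    ultimately show False
      by contradiction
  qed
  then show ?thesis ..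
qed

lemma common_factor_trivial:
  assumes "\<And>j. h dvd polar coord j"
  shows "total_degree h = 0"
proof -
  have "h dvd dot V (polar coord)"
    unfolding dot_def by (intro dvd_sum dvd_mult assms)
  also have "dot V (polar coord) = G coord"
    by (simp add: polar_def dot_linear dot_v_dG dot_commute[of V B] dot_B_V)
  finally have "h dvd (\<Prod>k\<in>I. lin_form (a k))"
    by (simp add: G_coord)
  \<comment> \<open>Such a form would divide every \<open>lin_form b * dG coord j\<close>; not
    dividing \<open>lin_form b\<close>, it would divide the whole gradient.\<close>
  moreover have "\<not> lin_form (a k) dvd h" if k: "k \<in> I" for k
  proof
    assume "lin_form (a k) dvd h"
    then have "lin_form (a k) dvd dot B coord * dG coord j + G coord * B j" for j
      using assms[of j] unfolding polar_def by (rule dvd_trans)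
    moreover have "lin_form (a k) dvd G coord * B j" for j
      unfolding G_coord using finite k by (intro dvd_mult2 dvd_prodI)
    ultimately have "lin_form (a k) dvd lin_form b * dG coord j" for j
      by (simp add: dvd_add_left_iff dot_B_coord)
    moreover have "\<not> lin_form (a k) dvd lin_form b"
      using cross_form_line[OF k] lin_form_dvd_lin_form by blast
    ultimately show False
      using form_not_dvd_gradient[OF k] lin_form_dvd_mult a_nonzero[OF k] by blast
  qed
  ultimately have "h dvd 1"
    by (intro dvd_prod_lin_form_unit[OF finite a_nonzero])
  then show ?thesis
    by (rule total_degree_unit)
qed

text \<open>Expressions with constant coefficients commute with substitution, so composing maps
  amounts to replacing the argument.\<close>

lemma subst3_G: "subst3 (G y) z = G (\<lambda>i. subst3 (y i) z)"
  by (simp add: G_def subst.hom_prod subst.hom_dot subst3_const)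

lemma subst3_dG: "subst3 (dG y j) z = dG (\<lambda>i. subst3 (y i) z) j"
  by (simp add: dG_def subst.hom_sum subst.hom_prod subst.hom_dot subst.hom_mult subst3_const)

lemma subst3_polar: "subst3 (polar y j) z = polar (\<lambda>i. subst3 (y i) z) j"
  by (simp add: polar_def subst.hom_add subst.hom_mult subst.hom_dot subst3_G subst3_dG subst3_const)

lemma subst3_polar_inv: "subst3 (polar_inv y j) z = polar_inv (\<lambda>i. subst3 (y i) z) j"
  by (simp add: polar_inv_def subst.hom_add subst.hom_mult subst.hom_dot subst.hom_cross
      subst3_G subst3_dG subst3_const)

section \<open>Degrees of the polar map and its inverse\<close>

lemma homogeneous_G:
  assumes "\<And>i. homogeneous 1 (y i)"
  shows "homogeneous (card I) (G y)"
proof -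
  have "homogeneous (\<Sum>k\<in>I. 0 + 1) (G y)"
    unfolding G_def by (intro homogeneous_prod homogeneous_dot homogeneous_const assms)
  then show ?thesis by simp
qed

lemma homogeneous_dG:
  assumes "\<And>i. homogeneous 1 (y i)"
  shows "homogeneous (card I - 1) (dG y j)"
  unfolding dG_def
proof (rule homogeneous_sum)
  fix k assume "k \<in> I"
  moreover have "homogeneous (0 + (\<Sum>l\<in>I - {k}. 0 + 1)) (A k j * (\<Prod>l\<in>I - {k}. dot (A l) y))"
    by (intro homogeneous_mult homogeneous_prod homogeneous_dot homogeneous_const assms)
  ultimately show "homogeneous (card I - 1) (A k j * (\<Prod>l\<in>I - {k}. dot (A l) y))"
    by simp
qed

lemma card_pos: "card I > 0"
  using finite nonempty by auto

lemma homogeneous_polar: "homogeneous (card I) (polar coord j)"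
proof -
  have "homogeneous (0 + 1 + (card I - 1)) (dot B coord * dG coord j)"
    by (intro homogeneous_mult homogeneous_dot homogeneous_const homogeneous_coord homogeneous_dG)
  moreover have "homogeneous (card I + 0) (G coord * B j)"
    by (intro homogeneous_mult homogeneous_G homogeneous_const homogeneous_coord)
  ultimately show ?thesis
    using card_pos by (simp add: polar_def homogeneous_add)
qed

lemma homogeneous_polar_inv: "homogeneous (card I) (polar_inv coord j)"
proof -
  have y: "homogeneous 1 (cross B coord i)" for i
    using homogeneous_cross[of 0 B 1 coord] homogeneous_const homogeneous_coord by auto
  have "homogeneous (1 + 0 + (0 + (card I - 1))) (dot coord V * cross B (dG (cross B coord)) j)"
    by (intro homogeneous_mult homogeneous_dot homogeneous_cross homogeneous_const
        homogeneous_coord homogeneous_dG y)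
  moreover have "homogeneous (card I + 0) (G (cross B coord) * V j)"
    by (intro homogeneous_mult homogeneous_G homogeneous_const y)
  ultimately show ?thesis
    using card_pos by (simp add: polar_inv_def homogeneous_add)
qed

section \<open>Nonvanishing of the factors in the composites\<close>

lemma ex_cross_B_coord: "\<exists>i. cross B coord i \<noteq> 0"
proof (rule ccontr)
  assume "\<not> ?thesis"
  then have "\<forall>i j. B i * coord j = B j * coord i"
    using cross_eq_0_iff[of B coord] by blast
  \<comment> \<open>At this unit vector the left side is \<open>b i\<close> and the right side is
    0.\<close>
  then have "eval3 (B i * coord (i + 1)) (axis (i + 1) 1) = eval3 (B (i + 1) * coord i) (axis (i + 1) 1)" for i
    by simp
  then have "b i = 0" for i
    by (simp add: eval.hom_mult eval3_const eval3_coord axis_def)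
  then show False
    using b_nonzero by auto
qed

lemma dG_coord_nonzero: "\<exists>j. dG coord j \<noteq> 0"
  using nonempty form_not_dvd_gradient by (metis dvd_0_right ex_in_conv)

lemma dG_cross_B_coord_nonzero: "\<exists>j. dG (cross B coord) j \<noteq> 0"
proof -
  obtain j where j: "dG coord j \<noteq> 0"
    using dG_coord_nonzero ..
  \<comment> \<open>Substituting \<open>cross coord V\<close> turns \<open>cross B coord\<close>
    into the coordinates minus a multiple of \<open>V\<close>, and the gradient ignores shifts along
    \<open>V\<close>.\<close>
  have "subst3 (dG (cross B coord) j) (cross coord V) = dG (cross B (cross coord V)) j"
    by (simp add: subst3_dG subst.hom_cross subst3_const subst3_coord)
  also have "\<dots> = dG coord j"
    by (rule dG_translate)
      (simp add: cross_cross_right[abs_def] dot_linear dot_B_V dot_a_v)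
  finally show ?thesis
    using j by (metis subst.hom_zero)
qed

text \<open>If one component vanished, parallelism would kill all of \<open>cross B (dG y)\<close>,
  and by \<open>dG_eq\<close> the gradient.\<close>

lemma cross_B_dG_nonzero:
  assumes "y i - dot B y * V i \<noteq> 0" "dG y j \<noteq> 0"
  shows "cross B (dG y) i \<noteq> 0"
proof
  assume "cross B (dG y) i = 0"
  then have "cross B (dG y) k = 0" for k
    using cross_b_dG_parallel[of y k i] assms(1) by simp
  then have "dG y j = 0"
    by (subst dG_eq) (simp add: cross_def[of V])
  with assms(2) show False ..
qed

lemma birational_polar: "birational (polar coord)"
proof -
  obtain i where i: "cross B coord i \<noteq> 0"
    using ex_cross_B_coord ..
  define d where "d = coord i - dot B coord * V i"
  \<comment> \<open>Substituting \<open>cross B coord\<close> kills \<open>dot B coord\<close>, so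
    \<open>d\<close> specialises to the nonzero component chosen above.\<close>
  have "subst3 d (cross B coord) = cross B coord i"
    by (simp add: d_def subst.hom_diff subst.hom_mult subst.hom_dot subst3_const subst3_coord
        dot_cross_self)
  with i have d: "d \<noteq> 0"
    by (metis subst.hom_zero)
  have G: "G coord \<noteq> 0"
    using finite a_nonzero by (simp add: G_coord lin_form_eq_0_iff)
  have "dot (A k) (cross B coord) = lin_form (cross (a k) b)" for k
    by (simp add: dot_cross_rotate lin_form_def const.hom_cross)
  then have Gy: "G (cross B coord) \<noteq> 0"
    using finite cross_form_line by (auto simp: G_def lin_form_eq_0_iff fun_eq_iff)
  have coord: "coord 1 \<noteq> (0 :: 'a poly3)"
    using eval3_coord[of 1 "axis 1 (1 :: 'a)"] by (auto simp: eval.hom_zero)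
  \<comment> \<open>\<open>E\<close> and, below, \<open>E'\<close> are the common factors from the
    two composite computations, taken at the coordinates.\<close>
  define E where "E = (dot B coord * cross B (dG coord) i) ^ (card I - 1) * cross B (dG coord) i * G coord"
  have E: "E \<noteq> 0"
    using cross_B_dG_nonzero[of coord i] d dG_coord_nonzero G b_nonzero
    by (auto simp: E_def d_def dot_B_coord lin_form_eq_0_iff)
  have E_eq: "d ^ card I * comp_map (polar_inv coord) (polar coord) j = E * coord j" for j
    by (simp add: comp_map_def subst3_polar_inv subst3_coord d_def E_def polar_inv_polar)
  define E' where "E' = (dot coord V * cross B (dG (cross B coord)) i) ^ (card I - 1) *
    cross B (dG (cross B coord)) i * G (cross B coord)"
  have "dot coord V = lin_form v"
    by (simp add: lin_form_def dot_commute)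
  then have E': "E' \<noteq> 0"
    using cross_B_dG_nonzero[of "cross B coord" i] i dG_cross_B_coord_nonzero Gy v_nonzero
    by (auto simp: E'_def lin_form_eq_0_iff dot_cross_self)
  have E'_eq: "cross B coord i ^ card I * comp_map (polar coord) (polar_inv coord) j = E' * coord j" for j
    by (simp add: comp_map_def subst3_polar subst3_coord E'_def polar_polar_inv)
  \<comment> \<open>Proportionality to the coordinates makes the minors vanish once \<open>D\<close>
    is cancelled.\<close>
  have same: "same_map \<Phi> coord"
    if "\<And>j. D * \<Phi> j = K * coord j" "D \<noteq> 0" for \<Phi> and D K :: "'a poly3"
    unfolding same_map_def
  proof (intro allI)
    fix i j
    have "D * (\<Phi> i * coord j) = K * coord i * coord j"
      by (simp flip: mult.assoc that(1))
    also have "\<dots> = D * (\<Phi> j * coord i)"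
      by (simp add: mult.commute[of "coord i"] mult.assoc[of K]) (simp flip: mult.assoc that(1))
    finally show "\<Phi> i * coord j = \<Phi> j * coord i"
      using that(2) by simp
  qed
  have nz: "\<Phi> 1 \<noteq> 0" if "\<And>j. D * \<Phi> j = K * coord j" "K \<noteq> 0" for \<Phi> and D K :: "'a poly3"
    using that(1)[of 1] that(2) coord by auto
  have nz1: "comp_map (polar_inv coord) (polar coord) 1 \<noteq> 0"
    by (rule nz[OF E_eq E])
  have nz2: "comp_map (polar coord) (polar_inv coord) 1 \<noteq> 0"
    by (rule nz[OF E'_eq E'])
  show ?thesis
    unfolding birational_def
  proof (intro conjI exI[of _ "polar_inv coord"])
    show "rational_map (polar coord)"
      unfolding rational_map_def
    proof (intro conjI exI allI)
      show "homogeneous (card I) (polar coord j)" for j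
        by (rule homogeneous_polar)
      \<comment> \<open>A zero component would remain zero in the composite, against
        \<open>nz2\<close>.\<close>
      show "polar coord 1 \<noteq> 0"
        using nz2 by (auto simp: comp_map_def subst.hom_zero)
    qed
    show "rational_map (polar_inv coord)"
      unfolding rational_map_def
    proof (intro conjI exI allI)
      show "homogeneous (card I) (polar_inv coord j)" for j
        by (rule homogeneous_polar_inv)
      show "polar_inv coord 1 \<noteq> 0"
        using nz1 by (auto simp: comp_map_def subst.hom_zero)
    qed
    have "homogeneous (card I * card I) (comp_map (polar_inv coord) (polar coord) j)" for j
      unfolding comp_map_def by (intro homogeneous_subst3 homogeneous_polar_inv homogeneous_polar)
    then show "rational_map (comp_map (polar_inv coord) (polar coord))"
      using nz1 unfolding rational_map_def by blast
    have "homogeneous (card I * card I) (comp_map (polar coord) (polar_inv coord) j)" for j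
      unfolding comp_map_def by (intro homogeneous_subst3 homogeneous_polar_inv homogeneous_polar)
    then show "rational_map (comp_map (polar coord) (polar_inv coord))"
      using nz2 unfolding rational_map_def by blast
    show "same_map (comp_map (polar_inv coord) (polar coord)) coord"
      by (rule same[OF E_eq]) (simp add: d)
    show "same_map (comp_map (polar coord) (polar_inv coord)) coord"
      by (rule same[OF E'_eq]) (simp add: i)
  qed
qed

lemma homogeneous_equation: "homogeneous (card I + 1) equation"
  unfolding equation_def
  using homogeneous_prod[of I "\<lambda>_. 1" "\<lambda>k. lin_form (a k)"]
  by (intro homogeneous_mult homogeneous_lin_form) (simp add: homogeneous_lin_form[unfolded One_nat_def])

lemma homaloidal_equation: "homaloidal equation"
  unfolding homaloidal_def polar_map_equation
  using homogeneous_equation common_factor_trivial birational_polar by blast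

end

section \<open>Zero loci\<close>

lemma proj_plane_span:
  fixes z :: "('a::field ^ 3) set"
  assumes "z \<in> proj_plane"
  obtains u where "z = range (\<lambda>c. c *s u)"
proof -
  from assms have z: "vec.subspace z" "vec.dim z = 1"
    by (simp_all add: proj_plane_def)
  obtain W where W: "W \<subseteq> z" "z \<subseteq> vec.span W" "card W = vec.dim z"
    using vec.basis_exists by metis
  then obtain u where "W = {u}"
    using z(2) by (metis card_1_singletonE)
  moreover have "vec.span W = z"
    using W z(1) vec.span_minimal by blast
  ultimately have "z = range (\<lambda>c. c *s u)"
    by (simp add: vec.span_singleton)
  then show ?thesis
    by (rule that)
qed

lemma eval3_scale:
  assumes "homogeneous d f"
  shows "eval3 f (c *s u) = c ^ d * eval3 f u"
  unfolding eval3_def sum_distrib_left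
proof (intro sum.cong refl)
  fix m assume "m \<in> Poly_Mapping.keys f"
  then have "(\<Prod>i\<in>UNIV. c ^ Poly_Mapping.lookup m i) = c ^ d"
    using assms by (auto simp: homogeneous_def mono_degree_def power_sum)
  then show "Poly_Mapping.lookup f m * (\<Prod>i\<in>UNIV. (c *s u) $ i ^ Poly_Mapping.lookup m i) =
      c ^ d * (Poly_Mapping.lookup f m * (\<Prod>i\<in>UNIV. u $ i ^ Poly_Mapping.lookup m i))"
    by (simp add: power_mult_distrib prod.distrib)
qed

text \<open>A point is spanned by one vector \<open>u\<close>. One factor vanishes at
  \<open>u\<close> and, by homogeneity, on all its multiples.\<close>

lemma zero_locus_mult:
  fixes f g :: "'a::field poly3"
  assumes "homogeneous d f" "homogeneous e g"
  shows "zero_locus (f * g) = zero_locus f \<union> zero_locus g"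
proof -
  have "(\<forall>v\<in>z. eval3 f v = 0) \<or> (\<forall>v\<in>z. eval3 g v = 0)"
    if "z \<in> proj_plane" "\<forall>v\<in>z. eval3 f v = 0 \<or> eval3 g v = 0" for z
  proof -
    from that(1) obtain u where u: "z = range (\<lambda>c. c *s u)"
      by (rule proj_plane_span)
    then have "1 *s u \<in> z"
      by blast
    then have "eval3 f u = 0 \<or> eval3 g u = 0"
      using that(2) by simp
    then show ?thesis
      using assms by (auto simp: u eval3_scale)
  qed
  then show ?thesis
    by (auto simp: zero_locus_def eval.hom_mult)
qed

lemma zero_locus_prod:
  fixes g :: "'i \<Rightarrow> 'a::field poly3"
  assumes "finite A" "\<And>k. k \<in> A \<Longrightarrow> homogeneous (e k) (g k)"
  shows "zero_locus (\<Prod>k\<in>A. g k) = (\<Union>k\<in>A. zero_locus (g k))"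
  using assms
proof (induction A rule: finite_induct)
  case empty
  \<comment> \<open>The empty product 1 has no zeros only because points, as subspaces, contain a
    vector.\<close>
  have "z \<noteq> {}" if "z \<in> proj_plane" for z :: "('a ^ 3) set"
    using that by (auto simp: proj_plane_def dest: vec.subspace_0)
  then show ?case
    by (auto simp: zero_locus_def eval.hom_one)
next
  case (insert k A)
  then have "homogeneous (\<Sum>k\<in>A. e k) (\<Prod>k\<in>A. g k)"
    by (intro homogeneous_prod) simp
  then show ?case
    using insert zero_locus_mult[of "e k" "g k"] by simp
qed

text \<open>Used in both directions, this shows that distinct lines have non-proportional
  forms.\<close>

lemma zero_locus_lin_form_subset:
  fixes a a' :: "3 \<Rightarrow> 'a::field"
  assumes "\<forall>i. cross a a' i = 0" "a \<noteq> (\<lambda>_. 0)"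
  shows "zero_locus (lin_form a) \<subseteq> zero_locus (lin_form a')"
proof -
  from assms(2) obtain i where i: "a i \<noteq> 0"
    by auto
  have "a i * dot a' u = a' i * dot a u" for u
  proof -
    have "a i * a' j = a' i * a j" for j
      using assms(1) unfolding cross_eq_0_iff by (metis mult.commute)
    then show ?thesis
      by (simp add: dot_def sum_distrib_left flip: mult.assoc)
  qed
  then have "dot a' u = 0" if "dot a u = 0" for u
    using that i by (metis mult_eq_0_iff)
  then show ?thesis
    by (auto simp: zero_locus_def eval3_lin_form)
qed

theorem theorem1:
  fixes p n :: nat and F :: "('a::alg_closed_field ^ 3) set set"
  assumes "CHAR('a) = p"
    and "n \<ge> 1"
    and "p dvd n"
    and "near_pencil n F"
  shows "homaloidal_curve F"
proof -
  from assms(4) obtain z0 \<L> M where z0: "z0 \<in> proj_plane"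
    and \<L>: "finite \<L>" "card \<L> = n" "\<And>L. L \<in> \<L> \<Longrightarrow> proj_line L \<and> z0 \<in> L"
    and M: "proj_line M" "z0 \<notin> M" and F: "F = \<Union>\<L> \<union> M"
    unfolding near_pencil_def by blast
  have proj_lineE: "\<exists>a. a \<noteq> (\<lambda>_. 0) \<and> L = zero_locus (lin_form a)" if "proj_line L" for L :: "('a ^ 3) set set"
    using that unfolding proj_line_def by (metis homogeneous_1E lin_form_eq_0_iff)
  have "\<exists>a. \<forall>L\<in>\<L>. a L \<noteq> (\<lambda>_. 0) \<and> L = zero_locus (lin_form (a L))"
    using \<L>(3) proj_lineE by (intro bchoice) blast
  then obtain a where a: "\<And>L. L \<in> \<L> \<Longrightarrow> a L \<noteq> (\<lambda>_. 0)"
      "\<And>L. L \<in> \<L> \<Longrightarrow> L = zero_locus (lin_form (a L))"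
    by blast
  obtain b where b: "M = zero_locus (lin_form b)"
    using proj_lineE[OF M(1)] by blast
  with M(2) z0 obtain u where u: "u \<in> z0" "dot b (($) u) \<noteq> 0"
    by (auto simp: zero_locus_def eval3_lin_form)
  \<comment> \<open>A vector of \<open>z0\<close> on which the form of \<open>M\<close> does not
    vanish, rescaled to give that form the value 1.\<close>
  define v where "v = (\<lambda>i. (1 / dot b (($) u)) * u $ i)"
  interpret near_pencil_forms \<L> a b v
  proof
    show "of_nat (card \<L>) = (0 :: 'a)"
      using assms(1,3) \<L>(2) by (simp add: of_nat_eq_0_iff_char_dvd)
    show "dot (a L) v = 0" if "L \<in> \<L>" for L
    proof -
      have "z0 \<in> zero_locus (lin_form (a L))"
        using a(2)[OF that] \<L>(3)[OF that] by simp
      then show ?thesis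
        using u(1) unfolding v_def dot_scale by (simp add: zero_locus_def eval3_lin_form)
    qed
    show "dot b v = 1"
      using u(2) unfolding v_def dot_scale by simp
    show "\<exists>i. cross (a L) (a L') i \<noteq> 0" if L: "L \<in> \<L>" "L' \<in> \<L>" "L \<noteq> L'" for L L'
    proof (rule ccontr)
      assume "\<not> ?thesis"
      then have "\<forall>i. cross (a L) (a L') i = 0" "\<forall>i. cross (a L') (a L) i = 0"
        by (simp, metis cross_commute neg_equal_0_iff_equal)
      then have "zero_locus (lin_form (a L)) = zero_locus (lin_form (a L'))"
        using a(1) L zero_locus_lin_form_subset by blast
      then show False
        using a(2) L by metis
    qed
  qed (use \<L>(1,2) assms(2) a(1) in auto)
  have "zero_locus equation = zero_locus (\<Prod>L\<in>\<L>. lin_form (a L)) \<union> zero_locus (lin_form b)"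
    unfolding equation_def
    by (rule zero_locus_mult[OF homogeneous_prod homogeneous_lin_form]) (rule homogeneous_lin_form)
  also have "zero_locus (\<Prod>L\<in>\<L>. lin_form (a L)) = (\<Union>L\<in>\<L>. zero_locus (lin_form (a L)))"
    by (rule zero_locus_prod[OF \<L>(1)]) (rule homogeneous_lin_form)
  also have "(\<Union>L\<in>\<L>. zero_locus (lin_form (a L))) \<union> zero_locus (lin_form b) = F"
    using a(2) by (simp add: F b)
  finally show ?thesis
    unfolding homaloidal_curve_def reduced_equation_def
    using homogeneous_equation squarefree_equation homaloidal_equation by blast
qed

end
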